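(* Let $m\le n$, let $A\in\mathbb{R}^{n\times n}$ be symmetric positive definite and let $B,C\in\mathbb{R}^{m\times n}$ satisfy $\operatorname{rank}(B)=\operatorname{rank}(C)=m$. Let $\alpha>0$. For every $x\in\mathcal{S}$ let $a(x)=x^*Ax$, $s(x)=\Re(x^*B^TCx)$ and $t(x)=\Im(x^*B^TCx)$, and suppose that for each $x\in\mathcal{S}$ one has $s(x)>0$ and $|t(x)|<a(x)\sqrt{s(x)}$. Then the preconditioned matrix $P_{RSS}^{-1}\mathcal{A}$ has an eigenvalue $1$ with algebraic multiplicity $n$, and the remaining eigenvalues are the eigenvalues of the matrix $$\frac1\alpha\, C\Bigl(A+\frac1\alpha B^TC\Bigr)^{-1}B^T.$$
   Context: $x^*$ denotes the conjugate transpose and $[x;y]=[x^T,y^T]^T$. The saddle point matrix is $$\mathcal{A}=\begin{bmatrix}A&B^T\\-C&0\end{bmatrix}\in\mathbb{R}^{(n+m)\times(n+m)},$$ the relaxed shift-splitting preconditioner is $$P_{RSS}=\begin{bmatrix}A&B^T\\-C&\alpha I\end{bmatrix},$$ and the iteration matrix of the shift-splitting method is $$M_\alpha=\begin{bmatrix}\alpha I+A&B^T\\-C&\alpha I\end{bmatrix}^{-1}\begin{bmatrix}\alpha I-A&-B^T\\C&\alpha I\end{bmatrix}.$$ The set $\mathcal{S}$ consists of all $x\in\mathbb{C}^n$ with $\|x\|_2=1$ for which there is $y\in\mathbb{C}^m$ such that $[x;y]$ is an eigenvector of $M_\alpha$.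
   Formalization: The formal theorem additionally assumes that P_RSS is invertible, since the stated conditions on S do not guarantee that the inverse of P_RSS exists; it also takes n > 0. *)

theory Defs
  imports
    "Jordan_Normal_Form.Char_Poly"
    "Jordan_Normal_Form.DL_Rank"
    "Jordan_Normal_Form.Gauss_Jordan_Elimination"
begin

text \<open>For a singular matrix the value of \<open>inv_mat\<close> is unspecified.\<close>
definition inv_mat :: "'a :: field mat \<Rightarrow> 'a mat" where
  "inv_mat M = the (mat_inverse M)"

abbreviation cmat :: "real mat \<Rightarrow> complex mat" where
  "cmat \<equiv> map_mat complex_of_real"

definition sym_pos_def :: "real mat \<Rightarrow> bool" where
  "sym_pos_def A \<longleftrightarrow> transpose_mat A = A \<and>
     (\<forall>v \<in> carrier_vec (dim_row A). v \<noteq> 0\<^sub>v (dim_row A) \<longrightarrow> v \<bullet> (A *\<^sub>v v) > 0)"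

definition norm2 :: "complex vec \<Rightarrow> real" where
  "norm2 x = sqrt (\<Sum>i < dim_vec x. (cmod (x $ i))\<^sup>2)"

definition star_form :: "complex vec \<Rightarrow> complex mat \<Rightarrow> complex" where
  "star_form x M = conjugate x \<bullet> (M *\<^sub>v x)"

text \<open>In the following, \<open>A\<close> is \<open>n \<times> n\<close> and \<open>B\<close>, \<open>C\<close> are \<open>m \<times> n\<close>.\<close>

definition saddle_mat :: "real mat \<Rightarrow> real mat \<Rightarrow> real mat \<Rightarrow> real mat" where
  "saddle_mat A B C =
     four_block_mat A (transpose_mat B) (- C) (0\<^sub>m (dim_row C) (dim_row C))"

text \<open>
  Conditions on the eigenvectors of \<open>iter_mat\<close> do not by themselves make \<open>P_RSS\<close>
  invertible: with \<open>\<alpha> = 1\<close>, \<open>n = m = 3\<close>, \<open>B = I\<close>, \<open>A = diag(1.47, 0.04, 29.32)\<close> and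
  \<open>C\<close> with rows \<open>(80.59, 100.92, -6.84)\<close>, \<open>(-18.77, -22.63, 2.18)\<close>,
  \<open>(-23.44, 30.6, 46.68)\<close>, every eigenvector satisfies \<open>s > 0\<close> and
  \<open>|t| < a sqrt s\<close>, but \<open>det (A + C) = 0\<close>, so \<open>P_RSS\<close> is singular. Invertibility is
  therefore a separate requirement wherever \<open>inv_mat (P_RSS \<alpha> A B C)\<close> is used.
\<close>
definition P_RSS :: "real \<Rightarrow> real mat \<Rightarrow> real mat \<Rightarrow> real mat \<Rightarrow> real mat" where
  "P_RSS \<alpha> A B C =
     four_block_mat A (transpose_mat B) (- C) (\<alpha> \<cdot>\<^sub>m 1\<^sub>m (dim_row C))"

definition iter_mat :: "real \<Rightarrow> real mat \<Rightarrow> real mat \<Rightarrow> real mat \<Rightarrow> real mat" where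
  "iter_mat \<alpha> A B C =
     inv_mat (four_block_mat
       (\<alpha> \<cdot>\<^sub>m 1\<^sub>m (dim_row A) + A) (transpose_mat B) (- C) (\<alpha> \<cdot>\<^sub>m 1\<^sub>m (dim_row C))) *
     four_block_mat
       (\<alpha> \<cdot>\<^sub>m 1\<^sub>m (dim_row A) - A) (- transpose_mat B) C (\<alpha> \<cdot>\<^sub>m 1\<^sub>m (dim_row C))"

definition S_set :: "real \<Rightarrow> real mat \<Rightarrow> real mat \<Rightarrow> real mat \<Rightarrow> complex vec set" where
  "S_set \<alpha> A B C =
     {x \<in> carrier_vec (dim_row A). norm2 x = 1 \<and>
        (\<exists>y \<in> carrier_vec (dim_row C). \<exists>k.
           eigenvector (cmat (iter_mat \<alpha> A B C)) (x @\<^sub>v y) k)}"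

text \<open>The form \<open>x\<^sup>* A x\<close> is real for symmetric \<open>A\<close>; taking \<open>Re\<close> only changes its type.\<close>
definition a_form :: "real mat \<Rightarrow> complex vec \<Rightarrow> real" where
  "a_form A x = Re (star_form x (cmat A))"

definition s_form :: "real mat \<Rightarrow> real mat \<Rightarrow> complex vec \<Rightarrow> real" where
  "s_form B C x = Re (star_form x (cmat (transpose_mat B * C)))"

definition t_form :: "real mat \<Rightarrow> real mat \<Rightarrow> complex vec \<Rightarrow> real" where
  "t_form B C x = Im (star_form x (cmat (transpose_mat B * C)))"

definition alg_mult :: "complex mat \<Rightarrow> complex \<Rightarrow> nat" where
  "alg_mult M k = Polynomial.order k (char_poly M)"

text \<open>All eigenvalues, each repeated according to its algebraic multiplicity.\<close>
definition eigvals :: "complex mat \<Rightarrow> complex multiset" where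
  "eigvals M = proots (char_poly M)"

end

theory Submission
  imports Defs
begin

text \<open>
  With \<open>K = A + (1/\<alpha>) B\<^sup>T C\<close>, \<open>X = K\<^sup>-\<^sup>1 B\<^sup>T\<close> and \<open>Q = (1/\<alpha>) C X\<close> one has
  \<open>P\<^sub>R\<^sub>S\<^sub>S [I, X; 0, Q] = \<A>\<close>, so the preconditioned matrix is block upper triangular and its
  characteristic polynomial is \<open>(\<lambda> - 1)\<^sup>n\<close> times that of \<open>Q\<close>. Moreover \<open>1\<close> is not an
  eigenvalue of \<open>Q\<close>: if \<open>Q v = v\<close> and \<open>u = X v\<close>, then
  \<open>B\<^sup>T v = K u = A u + B\<^sup>T Q v = A u + B\<^sup>T v\<close>, so \<open>A u = 0\<close>, whence \<open>u = 0\<close> and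
  \<open>v = (1/\<alpha>) C u = 0\<close>.
\<close>

section \<open>Inverses and determinants over a field\<close>

lemma invertible_mat_iff_det:
  fixes M :: "'a :: field mat"
  assumes M: "M \<in> carrier_mat n n"
  shows "invertible_mat M \<longleftrightarrow> det M \<noteq> 0"
proof
  assume "invertible_mat M"
  then obtain N where MN: "M * N = 1\<^sub>m n" and NM: "N * M = 1\<^sub>m (dim_row N)"
    using M unfolding invertible_mat_def inverts_mat_def by auto
  \<comment> \<open>\<open>invertible_mat\<close> leaves the shape of the inverse open; both
    dimensions are read off by comparing column counts in the two identities.\<close>
  have "dim_col N = n" using arg_cong[OF MN, of dim_col] by simp
  moreover have "dim_row N = n" using arg_cong[OF NM, of dim_col] M by simp
  ultimately have "N \<in> carrier_mat n n" by auto
  then have "det M * det N = 1" using det_mult[OF M] MN by (metis det_one)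
  then show "det M \<noteq> 0" by auto
next
  assume "det M \<noteq> 0"
  \<comment> \<open>\<open>undefined\<close> fills the extension slot of the record
    \<open>ring_mat\<close>; the units of the matrix ring do not depend on it.\<close>
  from det_non_zero_imp_unit[OF M this, of undefined]
  show "invertible_mat M"
    using M unfolding invertible_mat_def inverts_mat_def Units_def ring_mat_def by auto
qed

lemma inv_mat:
  fixes M :: "'a :: field mat"
  assumes M: "M \<in> carrier_mat n n" and inv: "invertible_mat M"
  shows "inv_mat M \<in> carrier_mat n n" "M * inv_mat M = 1\<^sub>m n" "inv_mat M * M = 1\<^sub>m n"
proof -
  have "det M \<noteq> 0" using inv invertible_mat_iff_det[OF M] by simp
  \<comment> \<open>\<open>None\<close> would mean that \<open>M\<close> is not a unit of the matrix
    ring, against the nonzero determinant; hence \<open>the\<close> in \<open>inv_mat\<close> meets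
    a proper value.\<close>
  then have "mat_inverse M \<noteq> None"
    using mat_inverse(1)[OF M, of undefined] det_non_zero_imp_unit[OF M, of undefined] by blast
  then have "mat_inverse M = Some (inv_mat M)" unfolding inv_mat_def by auto
  from mat_inverse(2)[OF M this]
  show "inv_mat M \<in> carrier_mat n n" "M * inv_mat M = 1\<^sub>m n" "inv_mat M * M = 1\<^sub>m n"
    by auto
qed

text \<open>Lets a product with an inverse be identified by verifying a factorization, so that the
  blocks of the inverse never have to be computed.\<close>

lemma inv_mat_mult_eqI:
  fixes M :: "'a :: field mat"
  assumes M: "M \<in> carrier_mat n n" and inv: "invertible_mat M"
    and X: "X \<in> carrier_mat n k" and eq: "M * X = Y"
  shows "inv_mat M * Y = X"
proof -
  note I = inv_mat[OF M inv]
  have "inv_mat M * Y = (inv_mat M * M) * X"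
    unfolding eq[symmetric] by (rule assoc_mult_mat[symmetric, OF I(1) M X])
  then show ?thesis using I(3) X by simp
qed

section \<open>Characteristic polynomials of block triangular and identity matrices\<close>

lemma char_poly_four_block_lower_left_zero:
  fixes A :: "'a :: idom mat"
  assumes A: "A \<in> carrier_mat n n" and B: "B \<in> carrier_mat n m" and D: "D \<in> carrier_mat m m"
  shows "char_poly (four_block_mat A B (0\<^sub>m m n) D) = char_poly A * char_poly D"
proof -
  \<comment> \<open>Forming the characteristic matrix keeps the zero lower left block, so its
    determinant splits into those of the diagonal blocks.\<close>
  have "char_poly_matrix (four_block_mat A B (0\<^sub>m m n) D) =
    four_block_mat (char_poly_matrix A) (map_mat (\<lambda>a. [:- a:]) B) (0\<^sub>m m n) (char_poly_matrix D)"
    by (rule eq_matI) (use A B D in \<open>auto simp: char_poly_matrix_def\<close>)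
  moreover have "map_mat (\<lambda>a. [:- a:]) B \<in> carrier_mat n m" using B by auto
  ultimately show ?thesis
    unfolding char_poly_def
    using det_four_block_mat_lower_left_zero[OF char_poly_matrix_closed[OF A] _ refl
        char_poly_matrix_closed[OF D]] by simp
qed

lemma char_poly_one_mat:
  "char_poly (1\<^sub>m n :: 'a :: comm_ring_1 mat) = [:- 1, 1:] ^ n"
proof -
  have "diag_mat (1\<^sub>m n :: 'a mat) = replicate n 1"
    by (rule nth_equalityI) (auto simp: diag_mat_def)
  then show ?thesis
    by (subst char_poly_upper_triangular[of _ n]) (auto simp: upper_triangular_def)
qed

lemma char_poly_nonzero:
  fixes M :: "'a :: idom mat"
  assumes "M \<in> carrier_mat n n"
  shows "char_poly M \<noteq> 0"
  using degree_monic_char_poly[OF assms] by auto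

lemma add_vec_left_cancel_zero:
  fixes x y :: "'a :: ab_group_add vec"
  assumes x: "x \<in> carrier_vec n" and y: "y \<in> carrier_vec n" and eq: "y = x + y"
  shows "x = 0\<^sub>v n"
proof (rule eq_vecI)
  fix i assume "i < dim_vec (0\<^sub>v n :: 'a vec)"
  then have i: "i < n" by simp
  have "y $ i = (x + y) $ i" by (rule arg_cong[OF eq])
  also have "\<dots> = x $ i + y $ i" using i y by simp
  finally show "x $ i = 0\<^sub>v n $ i" using i by simp
qed (use x in simp)

lemma smult_mat_mult_mat_vec:
  fixes M :: "'a :: comm_semiring_0 mat"
  assumes M: "M \<in> carrier_mat nr nc" and v: "v \<in> carrier_vec nc"
  shows "(k \<cdot>\<^sub>m M) *\<^sub>v v = k \<cdot>\<^sub>v (M *\<^sub>v v)"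
proof (rule eq_vecI)
  fix i assume "i < dim_vec (k \<cdot>\<^sub>v (M *\<^sub>v v))"
  then have i: "i < dim_row M" by simp
  then have "row (k \<cdot>\<^sub>m M) i = k \<cdot>\<^sub>v row M i" by simp
  then show "((k \<cdot>\<^sub>m M) *\<^sub>v v) $ i = (k \<cdot>\<^sub>v (M *\<^sub>v v)) $ i"
    using i M v by simp
qed simp

section \<open>Schur complement and block factorization\<close>

context
  fixes A B C :: "real mat" and n m :: nat and \<alpha> :: real
  assumes A: "A \<in> carrier_mat n n" and B: "B \<in> carrier_mat m n" and C: "C \<in> carrier_mat m n"
    and \<alpha>: "\<alpha> \<noteq> 0"
begin

abbreviation (input) "BT \<equiv> transpose_mat B"

text \<open>The Schur complement of the block \<open>\<alpha> I\<close> in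
  \<open>P_RSS\<close>.\<close>

abbreviation (input) "K \<equiv> A + (1 / \<alpha>) \<cdot>\<^sub>m (BT * C)"

abbreviation (input) "X \<equiv> inv_mat K * BT"

abbreviation (input) "Q \<equiv> (1 / \<alpha>) \<cdot>\<^sub>m (C * X)"

lemma K_carrier: "K \<in> carrier_mat n n"
  using A B C by auto

lemma P_RSS_carrier: "P_RSS \<alpha> A B C \<in> carrier_mat (n + m) (n + m)"
  unfolding P_RSS_def using A B C by auto

text \<open>Block column elimination makes \<open>P_RSS\<close> block upper triangular with diagonal
  blocks \<open>K\<close> and \<open>\<alpha> I\<close>. This is how invertibility passes from
  \<open>P_RSS\<close> to \<open>K\<close>.\<close>

lemma det_P_RSS: "det (P_RSS \<alpha> A B C) = det K * \<alpha> ^ m"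
proof -
  \<comment> \<open>Right multiplication by this unit triangular matrix adds the second block column
    times \<open>(1 / \<alpha>) C\<close> to the first, which cancels \<open>- C\<close> and
    completes \<open>A\<close> to \<open>K\<close>.\<close>
  let ?L = "four_block_mat (1\<^sub>m n) (0\<^sub>m n m) ((1 / \<alpha>) \<cdot>\<^sub>m C) (1\<^sub>m m)"
  have "P_RSS \<alpha> A B C * ?L = four_block_mat
      (A * 1\<^sub>m n + BT * ((1 / \<alpha>) \<cdot>\<^sub>m C)) (A * 0\<^sub>m n m + BT * 1\<^sub>m m)
      (- C * 1\<^sub>m n + (\<alpha> \<cdot>\<^sub>m 1\<^sub>m m) * ((1 / \<alpha>) \<cdot>\<^sub>m C)) (- C * 0\<^sub>m n m + (\<alpha> \<cdot>\<^sub>m 1\<^sub>m m) * 1\<^sub>m m)"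
    unfolding P_RSS_def carrier_matD(1)[OF C]
    by (rule mult_four_block_mat) (use A B C in auto)
  also have "\<dots> = four_block_mat K BT (0\<^sub>m m n) (\<alpha> \<cdot>\<^sub>m 1\<^sub>m m)"
  proof (rule cong_four_block_mat)
    show "A * 1\<^sub>m n + BT * ((1 / \<alpha>) \<cdot>\<^sub>m C) = K"
      using A B C by (simp add: mult_smult_distrib[of _ n m _ n])
    show "A * 0\<^sub>m n m + BT * 1\<^sub>m m = BT" using A B by simp
    show "- C * 1\<^sub>m n + (\<alpha> \<cdot>\<^sub>m 1\<^sub>m m) * ((1 / \<alpha>) \<cdot>\<^sub>m C) = 0\<^sub>m m n"
      using C \<alpha> by (simp add: mult_smult_assoc_mat[of _ m m _ n]) (rule eq_matI, auto)
    show "- C * 0\<^sub>m n m + (\<alpha> \<cdot>\<^sub>m 1\<^sub>m m) * 1\<^sub>m m = \<alpha> \<cdot>\<^sub>m 1\<^sub>m m"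
      using C by simp
  qed
  finally have eq: "P_RSS \<alpha> A B C * ?L = four_block_mat K BT (0\<^sub>m m n) (\<alpha> \<cdot>\<^sub>m 1\<^sub>m m)" .
  have L: "?L \<in> carrier_mat (n + m) (n + m)" using C by auto
  have "det ?L = 1"
    using C by (subst det_four_block_mat_upper_right_zero[of _ n _ m]) auto
  moreover have "det (four_block_mat K BT (0\<^sub>m m n) (\<alpha> \<cdot>\<^sub>m 1\<^sub>m m)) = det K * \<alpha> ^ m"
    using B by (subst det_four_block_mat_lower_left_zero[OF K_carrier]) auto
  ultimately show ?thesis
    using det_mult[OF P_RSS_carrier L] eq by simp
qed

context
  assumes K_inv: "invertible_mat K"
begin

lemma X_carrier: "X \<in> carrier_mat n m"
  using inv_mat(1)[OF K_carrier K_inv] B by auto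

lemma Q_carrier: "Q \<in> carrier_mat m m"
  using X_carrier C by auto

lemma K_mult_X: "K * X = BT"
proof -
  have "K * X = (K * inv_mat K) * BT"
    using assoc_mult_mat[OF K_carrier inv_mat(1)[OF K_carrier K_inv], of BT m] B by simp
  then show ?thesis using inv_mat(2)[OF K_carrier K_inv] B by simp
qed

text \<open>This is \<open>K * X = BT\<close> with the summand \<open>(1 / \<alpha>) BT C X\<close>
  regrouped as \<open>BT * Q\<close>. It gives the upper right block of the factorization and the
  equation that excludes the eigenvalue 1 of \<open>Q\<close>.\<close>

lemma A_mult_X: "A * X + BT * Q = BT"
proof -
  have BT: "BT \<in> carrier_mat n m" using B by simp
  have "K * X = A * X + ((1 / \<alpha>) \<cdot>\<^sub>m (BT * C)) * X"
    by (rule add_mult_distrib_mat[OF A _ X_carrier]) (use BT C in auto)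
  also have "((1 / \<alpha>) \<cdot>\<^sub>m (BT * C)) * X = (1 / \<alpha>) \<cdot>\<^sub>m (BT * C * X)"
    by (rule mult_smult_assoc_mat[OF _ X_carrier]) (use BT C in auto)
  also have "BT * C * X = BT * (C * X)"
    by (rule assoc_mult_mat[OF BT C X_carrier])
  also have "(1 / \<alpha>) \<cdot>\<^sub>m (BT * (C * X)) = BT * Q"
    by (rule mult_smult_distrib[OF BT, symmetric]) (use C X_carrier in auto)
  finally show ?thesis using K_mult_X by simp
qed

lemma P_RSS_factorization:
  "P_RSS \<alpha> A B C * four_block_mat (1\<^sub>m n) X (0\<^sub>m m n) Q = saddle_mat A B C"
proof -
  have BT: "BT \<in> carrier_mat n m" using B by simp
  have "P_RSS \<alpha> A B C * four_block_mat (1\<^sub>m n) X (0\<^sub>m m n) Q = four_block_mat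
      (A * 1\<^sub>m n + BT * 0\<^sub>m m n) (A * X + BT * Q)
      (- C * 1\<^sub>m n + (\<alpha> \<cdot>\<^sub>m 1\<^sub>m m) * 0\<^sub>m m n) (- C * X + (\<alpha> \<cdot>\<^sub>m 1\<^sub>m m) * Q)"
    unfolding P_RSS_def carrier_matD(1)[OF C]
    by (rule mult_four_block_mat[OF A BT _ _ _ X_carrier _ Q_carrier]) (use C in auto)
  also have "\<dots> = four_block_mat A BT (- C) (0\<^sub>m m m)"
  proof (rule cong_four_block_mat)
    show "A * 1\<^sub>m n + BT * 0\<^sub>m m n = A" using A BT by simp
    show "A * X + BT * Q = BT" by (rule A_mult_X)
    show "- C * 1\<^sub>m n + (\<alpha> \<cdot>\<^sub>m 1\<^sub>m m) * 0\<^sub>m m n = - C" using C by simp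
    have CX: "C * X \<in> carrier_mat m m" using C X_carrier by auto
    have "(\<alpha> \<cdot>\<^sub>m 1\<^sub>m m) * Q = \<alpha> \<cdot>\<^sub>m (1\<^sub>m m * Q)"
      by (rule mult_smult_assoc_mat[OF _ Q_carrier]) auto
    also have "1\<^sub>m m * Q = Q" by (rule left_mult_one_mat[OF Q_carrier])
    also have "\<alpha> \<cdot>\<^sub>m Q = C * X"
      by (rule eq_matI) (use CX \<alpha> in auto)
    finally have "(\<alpha> \<cdot>\<^sub>m 1\<^sub>m m) * Q = C * X" .
    moreover have "- C * X = - (C * X)"
      by (rule uminus_mult_left_mat) (use C X_carrier in auto)
    \<comment> \<open>The scaling \<open>1 / \<alpha>\<close> in \<open>Q\<close> is chosen so that
      \<open>\<alpha> Q = C X\<close> cancels \<open>- C X\<close>.\<close>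
    ultimately show "- C * X + (\<alpha> \<cdot>\<^sub>m 1\<^sub>m m) * Q = 0\<^sub>m m m"
      using uminus_l_inv_mat[OF CX] by simp
  qed
  finally show ?thesis unfolding saddle_mat_def using C by simp
qed

text \<open>Ensures that the identity block alone contributes the eigenvalue 1, so that its
  multiplicity is exactly \<open>n\<close> and not merely at least \<open>n\<close>.\<close>

lemma one_not_eigenvalue_Q:
  assumes det: "det A \<noteq> 0"
  shows "\<not> eigenvalue Q 1"
proof
  have BT: "BT \<in> carrier_mat n m" using B by simp
  assume "eigenvalue Q 1"
  then obtain v where v: "v \<in> carrier_vec m" "v \<noteq> 0\<^sub>v m" and Qv: "Q *\<^sub>v v = v"
    unfolding eigenvalue_def eigenvector_def using Q_carrier by auto
  define u where "u = X *\<^sub>v v"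
  have u: "u \<in> carrier_vec n" unfolding u_def using X_carrier v by simp
  have CX: "C * X \<in> carrier_mat m m" using C X_carrier by auto
  have "BT *\<^sub>v v = (A * X + BT * Q) *\<^sub>v v" by (simp only: A_mult_X)
  also have "\<dots> = (A * X) *\<^sub>v v + (BT * Q) *\<^sub>v v"
    by (rule add_mult_distrib_mat_vec[of _ n m])
      (use A BT X_carrier Q_carrier v in \<open>auto intro!: mult_carrier_mat\<close>)
  also have "(A * X) *\<^sub>v v = A *\<^sub>v u"
    unfolding u_def by (rule assoc_mult_mat_vec[OF A X_carrier v(1)])
  also have "(BT * Q) *\<^sub>v v = BT *\<^sub>v v"
    using assoc_mult_mat_vec[OF BT Q_carrier v(1)] Qv by simp
  finally have eq: "BT *\<^sub>v v = A *\<^sub>v u + BT *\<^sub>v v" .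
  have "A *\<^sub>v u = 0\<^sub>v n"
    by (rule add_vec_left_cancel_zero[OF _ _ eq]) (use A BT u v in auto)
  then have "u = 0\<^sub>v n" using det det_0_iff_vec_prod_zero[OF A] u by auto
  then have "(C * X) *\<^sub>v v = 0\<^sub>v m"
    using assoc_mult_mat_vec[OF C X_carrier v(1)] C unfolding u_def by auto
  then have "Q *\<^sub>v v = 0\<^sub>v m"
    using smult_mat_mult_mat_vec[OF CX v(1), of "1 / \<alpha>"]
    by (simp, intro eq_vecI, auto)
  then show False using Qv v by simp
qed

end
end

section \<open>Positive definiteness and the spectrum of the preconditioned matrix\<close>

lemma sym_pos_def_det:
  assumes A: "A \<in> carrier_mat n n" and pd: "sym_pos_def A"
  shows "det A \<noteq> 0"
proof
  assume "det A = 0"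
  then obtain v where v: "v \<in> carrier_vec n" "v \<noteq> 0\<^sub>v n" "A *\<^sub>v v = 0\<^sub>v n"
    using det_0_iff_vec_prod_zero[OF A] by auto
  then have "v \<bullet> (A *\<^sub>v v) > 0" using pd A unfolding sym_pos_def_def by auto
  then show False using v by simp
qed

theorem theorem4:
  fixes A B C :: "real mat" and n m :: nat and \<alpha> :: real
  assumes "0 < n" and "m \<le> n"
    and "A \<in> carrier_mat n n" and "sym_pos_def A"
    and "B \<in> carrier_mat m n" and "C \<in> carrier_mat m n"
    and "vec_space.rank m B = m" and "vec_space.rank m C = m"
    and "0 < \<alpha>"
    and "\<forall>x \<in> S_set \<alpha> A B C.
           s_form B C x > 0 \<and> \<bar>t_form B C x\<bar> < a_form A x * sqrt (s_form B C x)"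
    and "invertible_mat (P_RSS \<alpha> A B C)"
  shows "let T = cmat (inv_mat (P_RSS \<alpha> A B C) * saddle_mat A B C);
             K = A + (1 / \<alpha>) \<cdot>\<^sub>m (transpose_mat B * C);
             Q = cmat ((1 / \<alpha>) \<cdot>\<^sub>m (C * inv_mat K * transpose_mat B))
         in invertible_mat K \<and>
            eigenvalue T 1 \<and> alg_mult T 1 = n \<and>
            eigvals T = replicate_mset n 1 + eigvals Q"
proof -
  note A = assms(3) and B = assms(5) and C = assms(6)
  have \<alpha>: "\<alpha> \<noteq> 0" using assms(9) by simp
  let ?P = "P_RSS \<alpha> A B C"
  let ?K = "A + (1 / \<alpha>) \<cdot>\<^sub>m (transpose_mat B * C)"
  let ?X = "inv_mat ?K * transpose_mat B"
  let ?Q = "(1 / \<alpha>) \<cdot>\<^sub>m (C * inv_mat ?K * transpose_mat B)"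
  let ?R = "inv_mat ?P * saddle_mat A B C"
  let ?F = "four_block_mat (1\<^sub>m n) ?X (0\<^sub>m m n) ?Q"
  note Kc = K_carrier[OF A B C \<alpha>] and Pc = P_RSS_carrier[OF A B C \<alpha>]
  have "det ?P \<noteq> 0" using assms(11) invertible_mat_iff_det[OF Pc] by simp
  then have K_inv: "invertible_mat ?K"
    using det_P_RSS[OF A B C \<alpha>] invertible_mat_iff_det[OF Kc] by simp
  \<comment> \<open>Rebrackets the triple product so that the lemmas about \<open>C * X\<close>
    apply.\<close>
  have Q_eq: "?Q = (1 / \<alpha>) \<cdot>\<^sub>m (C * ?X)"
    using assoc_mult_mat[OF C inv_mat(1)[OF Kc K_inv], of "transpose_mat B" m] B by simp
  note Xc = X_carrier[OF A B C \<alpha> K_inv]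
  have Qc: "?Q \<in> carrier_mat m m"
    unfolding Q_eq by (rule Q_carrier[OF A B C \<alpha> K_inv])
  have Fc: "?F \<in> carrier_mat (n + m) (n + m)"
    using Qc by (intro four_block_carrier_mat) auto
  have R: "?R = ?F"
    by (rule inv_mat_mult_eqI[OF Pc assms(11) Fc])
      (unfold Q_eq, rule P_RSS_factorization[OF A B C \<alpha> K_inv])
  \<comment> \<open>Characteristic polynomials are computed over the reals and then carried to the
    complex numbers by the embedding of coefficients.\<close>
  let ?p = "map_poly complex_of_real (char_poly ?Q)"
  have cp_Q: "char_poly (cmat ?Q) = ?p"
    by (rule of_real_hom.char_poly_hom[OF Qc])
  have "char_poly (cmat ?R) = map_poly complex_of_real ([:- 1, 1:] ^ n * char_poly ?Q)"
    unfolding R of_real_hom.char_poly_hom[OF Fc]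
      char_poly_four_block_lower_left_zero[OF one_carrier_mat Xc Qc] char_poly_one_mat ..
  also have "\<dots> = [:- 1, 1:] ^ n * ?p"
  proof -
    interpret map_poly_comm_ring_hom complex_of_real ..
    show ?thesis by (simp add: hom_distribs)
  qed
  finally have cp_T: "char_poly (cmat ?R) = [:- 1, 1:] ^ n * ?p" .
  \<comment> \<open>\<open>proots\<close> turns a product into a sum only when the factors are
    nonzero.\<close>
  have p_0: "?p \<noteq> 0" using char_poly_nonzero[OF Qc] by simp
  have eig: "eigvals (cmat ?R) = replicate_mset n 1 + eigvals (cmat ?Q)"
    unfolding eigvals_def cp_T cp_Q
    by (subst proots_mult[OF _ p_0]) (simp_all add: proots_power)
  have "poly (char_poly ?Q) 1 \<noteq> 0"
    using one_not_eigenvalue_Q[OF A B C \<alpha> K_inv sym_pos_def_det[OF A assms(4)]]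
    unfolding Q_eq[symmetric] eigenvalue_root_char_poly[OF Qc] .
  then have "poly ?p 1 \<noteq> 0"
    by (metis of_real_hom.poly_map_poly_1 of_real_eq_0_iff)
  then have "count (eigvals (cmat ?Q)) 1 = 0"
    unfolding eigvals_def cp_Q using p_0 by (simp add: order_0I)
  then have "count (eigvals (cmat ?R)) 1 = n"
    unfolding eig by simp
  then have mult: "alg_mult (cmat ?R) 1 = n"
    unfolding eigvals_def alg_mult_def using cp_T p_0 by simp
  have Rc: "cmat ?R \<in> carrier_mat (n + m) (n + m)" unfolding R using Fc by simp
  \<comment> \<open>At 1 the first factor evaluates to \<open>0 ^ n\<close>, which vanishes because
    \<open>n\<close> is positive.\<close>
  have "eigenvalue (cmat ?R) 1"
    unfolding eigenvalue_root_char_poly[OF Rc] cp_T using assms(1) by simp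
  then show ?thesis
    unfolding Let_def using K_inv mult eig by blast
qed

end
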